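(* The power $\frac{2m}{m+1}$ in the (complex) polynomial and multilinear Bohnenblust--Hille inequalities is sharp. That is, for every positive integer $m$ and every real $q$ with $0<q<\frac{2m}{m+1}$: (a) there is no constant $C_{m,q}>0$ such that $\left(\sum_{|\alpha|=m}|a_\alpha|^q\right)^{1/q}\le C_{m,q}\,\|P\|$ for every positive integer $n$ and every $m$-homogeneous polynomial $P(z)=\sum_{|\alpha|=m}a_\alpha z^\alpha$ on $\ell_\infty^n(\mathbb{C})$; (b) there is no constant $C_{m,q}>0$ such that $\left(\sum_{i_1,\ldots,i_m=1}^n|U(e_{i_1},\ldots,e_{i_m})|^q\right)^{1/q}\le C_{m,q}\,\|U\|$ for every positive integer $n$ and every $m$-linear form $U:\ell_\infty^n(\mathbb{C})\times\cdots\times\ell_\infty^n(\mathbb{C})\to\mathbb{C}$.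
   Context: $\ell_\infty^n(\mathbb{C})$ is $\mathbb{C}^n$ with the sup norm and $(e_i)$ is its canonical basis; $\|P\|$ and $\|U\|$ denote the supremum of $|P(z)|$, respectively $|U(z_1,\ldots,z_m)|$, over the unit ball (polydisc) of $\ell_\infty^n(\mathbb{C})$ (in each variable). For a multi-index $\alpha=(\alpha_1,\ldots,\alpha_n)$ of nonnegative integers, $|\alpha|=\alpha_1+\cdots+\alpha_n$ and $z^\alpha=z_1^{\alpha_1}\cdots z_n^{\alpha_n}$. The polynomial and multilinear Bohnenblust--Hille inequalities assert that for each $m$ the corresponding inequalities hold with exponent $q=\frac{2m}{m+1}$ and some constant depending only on $m$. *)

theory Defs
  imports Complex_Main "Jordan_Normal_Form.Matrix"
begin

text \<open>The space \<open>\<ell>\<^sub>\<infinity>\<^sup>n(\<complex>)\<close> is \<open>carrier_vec n :: complex vec set\<close> with the sup norm;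
  coordinates are indexed by \<open>{..<n}\<close> and the canonical basis is \<open>unit_vec n i\<close>.\<close>

text \<open>Inserting \<open>0\<close> only matters in dimension \<open>0\<close>, where \<open>Max {}\<close> would be unspecified.\<close>

definition linf_norm :: "complex vec \<Rightarrow> real" where
  "linf_norm z = Max (insert 0 ((\<lambda>i. cmod (z $ i)) ` {..<dim_vec z}))"

definition polydisc :: "nat \<Rightarrow> complex vec set" where
  "polydisc n = {z \<in> carrier_vec n. linf_norm z \<le> 1}"

definition multi_indices :: "nat \<Rightarrow> nat \<Rightarrow> nat vec set" where
  "multi_indices n m = {\<alpha> \<in> carrier_vec n. (\<Sum>i<n. \<alpha> $ i) = m}"

lemma finite_multi_indices: "finite (multi_indices n m)"
proof (rule finite_subset)
  show "multi_indices n m \<subseteq> vec_of_list ` {xs. set xs \<subseteq> {..m} \<and> length xs = n}"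
  proof
    fix \<alpha> assume "\<alpha> \<in> multi_indices n m"
    then have d: "dim_vec \<alpha> = n" and s: "(\<Sum>i<n. \<alpha> $ i) = m"
      by (auto simp: multi_indices_def)
    have "\<alpha> $ i \<le> m" if "i < n" for i
      using member_le_sum[of i "{..<n}" "\<lambda>i. \<alpha> $ i"] that s by simp
    then have "set (list_of_vec \<alpha>) \<subseteq> {..m}"
      using d by (auto simp: in_set_conv_nth list_of_vec_index)
    moreover have "\<alpha> = vec_of_list (list_of_vec \<alpha>)"
      by (simp add: vec_list)
    ultimately show "\<alpha> \<in> vec_of_list ` {xs. set xs \<subseteq> {..m} \<and> length xs = n}"
      using d by (intro image_eqI[of _ _ "list_of_vec \<alpha>"]) auto
  qed
qed (simp add: finite_lists_length_eq)

definition monomial :: "complex vec \<Rightarrow> nat vec \<Rightarrow> complex" where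
  "monomial z \<alpha> = (\<Prod>i<dim_vec z. (z $ i) ^ (\<alpha> $ i))"

text \<open>The \<open>m\<close>-homogeneous polynomial in \<open>n\<close> variables with coefficient family \<open>a\<close>;
  only the values of \<open>a\<close> on \<open>multi_indices n m\<close> matter.\<close>

definition hom_poly :: "nat \<Rightarrow> nat \<Rightarrow> (nat vec \<Rightarrow> complex) \<Rightarrow> complex vec \<Rightarrow> complex" where
  "hom_poly n m a z = (\<Sum>\<alpha>\<in>multi_indices n m. a \<alpha> * monomial z \<alpha>)"

text \<open>The real suprema below are taken over nonempty sets, which are bounded above for
  polynomials and for multilinear forms in finitely many variables.\<close>

definition poly_norm :: "nat \<Rightarrow> (complex vec \<Rightarrow> complex) \<Rightarrow> real" where
  "poly_norm n P = (SUP z\<in>polydisc n. cmod (P z))"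

text \<open>A function of \<open>m\<close> vectors takes them as a list of length \<open>m\<close>; its values elsewhere
  are irrelevant.\<close>

definition multilinear_form :: "nat \<Rightarrow> nat \<Rightarrow> (complex vec list \<Rightarrow> complex) \<Rightarrow> bool" where
  "multilinear_form n m U \<longleftrightarrow>
     (\<forall>zs k. length zs = m \<and> set zs \<subseteq> carrier_vec n \<and> k < m \<longrightarrow>
        (\<forall>x\<in>carrier_vec n. \<forall>y\<in>carrier_vec n.
           U (zs[k := x + y]) = U (zs[k := x]) + U (zs[k := y])) \<and>
        (\<forall>c. \<forall>x\<in>carrier_vec n. U (zs[k := c \<cdot>\<^sub>v x]) = c * U (zs[k := x])))"

definition multilinear_norm :: "nat \<Rightarrow> nat \<Rightarrow> (complex vec list \<Rightarrow> complex) \<Rightarrow> real" where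
  "multilinear_norm n m U =
     (SUP zs\<in>{zs. length zs = m \<and> set zs \<subseteq> polydisc n}. cmod (U zs))"

end

theory Submission
  imports Defs "HOL-Analysis.Convex"
begin

text \<open>Both inequalities are defeated by one \<open>m\<close>-linear form on \<open>\<complex>\<^sup>n\<close>, built by chaining copies of
  the Fourier matrix \<open>w i j = exp (2 \<pi> \<i> i j / n)\<close>:
  \[ U(z_1,\ldots,z_m) = \sum_{i_1,\ldots,i_m} w_{i_1 i_2} w_{i_2 i_3} \cdots w_{i_{m-1} i_m}
       z_1(i_1) \cdots z_m(i_m). \]
  All its \<open>n\<^sup>m\<close> coefficients are unimodular, so the left-hand side of the multilinear inequality
  is \<open>n powr (m / q)\<close>. The norm, however, is at most \<open>n powr ((m + 1) / 2)\<close>. To see this, sum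
  from the last variable backwards: one starts with a vector of \<open>\<ell>\<^sub>2\<close> norm at most \<open>sqrt n\<close>;
  each of the \<open>m - 1\<close> applications of \<open>w\<close> multiplies the \<open>\<ell>\<^sub>2\<close> norm by exactly \<open>sqrt n\<close>
  (\<open>dft_plancherel\<close>), and each pointwise multiplication by a vector with entries in the unit disc
  does not increase it; the final sum over \<open>i\<^sub>1\<close> costs another \<open>sqrt n\<close> by the Cauchy--Schwarz
  inequality (\<open>chain_form_bound\<close>). A uniform constant would therefore force
  \<open>m / q \<le> (m + 1) / 2\<close>, that is, \<open>q \<ge> 2 m / (m + 1)\<close> (\<open>no_uniform_constant\<close>).

  For polynomials, the \<open>m\<close> arguments of \<open>U\<close> are read off from \<open>m\<close> disjoint blocks of \<open>n\<close>
  coordinates of a single vector in \<open>\<complex>\<^bsup>m n\<^esup>\<close>. Because the blocks are disjoint, different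
  index tuples give different monomials, so no coefficients merge: the resulting polynomial has the
  same nonzero coefficients as \<open>U\<close>, and its norm is at most that of \<open>U\<close>.\<close>

section \<open>The Fourier matrix\<close>

definition dft :: "nat \<Rightarrow> nat \<Rightarrow> nat \<Rightarrow> complex" where
  "dft n i j = cis (2 * pi * real i * real j / real n)"

lemma cmod_dft [simp]: "cmod (dft n i j) = 1"
  by (simp add: dft_def)

text \<open>Off the diagonal this is a geometric sum over the powers of an \<open>n\<close>-th root of unity,
  which is not \<open>1\<close> because \<open>j\<close> and \<open>j'\<close> are not congruent modulo \<open>n\<close>.\<close>

lemma dft_orthogonal:
  assumes "j < n" "j' < n"
  shows "(\<Sum>i<n. dft n i j * cnj (dft n i j')) = (if j = j' then of_nat n else 0)"
proof (cases "j = j'")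
  case True
  have "dft n i j * cnj (dft n i j) = 1" for i
    by (simp flip: complex_norm_square)
  with True show ?thesis by simp
next
  case False
  define x where "x = 2 * pi * (real j - real j') / real n"
  have pow: "dft n i j * cnj (dft n i j') = cis x ^ i" for i
    by (simp add: dft_def cis_cnj cis_mult DeMoivre x_def diff_divide_distrib algebra_simps)
  have "cis x \<noteq> 1"
  proof
    assume "cis x = 1"
    then have "cos x = 1" by (metis cis.sel(1) one_complex.sel(1))
    then obtain k :: int where "x = real_of_int k * 2 * pi"
      by (auto simp: cos_one_2pi_int)
    with assms have "2 * pi * (real j - real j') = 2 * pi * (real_of_int k * real n)"
      by (simp add: x_def divide_eq_eq mult_ac)
    then have "real j - real j' = real_of_int k * real n"
      by simp
    then have eq: "int j - int j' = k * int n"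
      by (metis of_int_eq_iff of_int_mult of_int_diff of_int_of_nat_eq)
    then have "\<bar>k * int n\<bar> < int n"
      using assms by linarith
    then have "k = 0" using assms by (simp add: abs_mult)
    with eq False show False by simp
  qed
  moreover have "cis x ^ n = 1"
  proof -
    have "cis x ^ n = cis (2 * pi * real_of_int (int j - int j'))"
      using assms by (simp add: DeMoivre x_def)
    also have "\<dots> = 1" by (rule cis_multiple_2pi) (rule Ints_of_int)
    finally show ?thesis .
  qed
  ultimately show ?thesis
    using False by (simp add: pow geometric_sum)
qed

lemma dft_plancherel:
  "(\<Sum>i<n. (cmod (\<Sum>j<n. dft n i j * x j))\<^sup>2) = real n * (\<Sum>j<n. (cmod (x j))\<^sup>2)"
proof -
  have "complex_of_real (\<Sum>i<n. (cmod (\<Sum>j<n. dft n i j * x j))\<^sup>2)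
      = (\<Sum>i<n. \<Sum>j<n. \<Sum>j'<n. x j * cnj (x j') * (dft n i j * cnj (dft n i j')))"
    by (simp add: complex_norm_square sum_product mult_ac del: of_real_power)
  also have "\<dots> = (\<Sum>j<n. \<Sum>i<n. \<Sum>j'<n. x j * cnj (x j') * (dft n i j * cnj (dft n i j')))"
    by (rule sum.swap)
  also have "\<dots> = (\<Sum>j<n. \<Sum>j'<n. \<Sum>i<n. x j * cnj (x j') * (dft n i j * cnj (dft n i j')))"
    by (intro sum.cong refl sum.swap)
  also have "\<dots> = (\<Sum>j<n. \<Sum>j'<n. x j * cnj (x j') * (if j = j' then of_nat n else 0))"
    by (intro sum.cong refl) (simp add: dft_orthogonal flip: sum_distrib_left)
  also have "\<dots> = (\<Sum>j<n. x j * cnj (x j) * of_nat n)"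
    by (intro sum.cong refl) (simp add: if_distrib cong: if_cong)
  also have "\<dots> = complex_of_real (real n * (\<Sum>j<n. (cmod (x j))\<^sup>2))"
    by (simp add: complex_norm_square sum_distrib_left mult_ac del: of_real_power)
  finally show ?thesis by (simp only: of_real_eq_iff)
qed

section \<open>Chaining the Fourier matrix\<close>

abbreviation index_tuples :: "nat \<Rightarrow> nat \<Rightarrow> nat list set" where
  "index_tuples n m \<equiv> {js. length js = m \<and> set js \<subseteq> {..<n}}"

lemma finite_index_tuples [simp]: "finite (index_tuples n m)"
  using finite_lists_length_eq[of "{..<n}" m] by (simp add: conj_commute)

lemma index_tuples_nth: "js \<in> index_tuples n m \<Longrightarrow> k < m \<Longrightarrow> js ! k < n"
  by (metis (mono_tags, lifting) lessThan_iff mem_Collect_eq nth_mem subsetD)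

lemma card_index_tuples: "card (index_tuples n m) = n ^ m"
  using card_lists_length_eq[of "{..<n}" m] by (simp add: conj_commute)

lemma sum_index_tuples_Suc:
  "(\<Sum>js\<in>index_tuples n (Suc m). f js) = (\<Sum>j<n. \<Sum>js\<in>index_tuples n m. f (j # js))"
proof -
  have "index_tuples n (Suc m) = (\<lambda>(j, js). j # js) ` ({..<n} \<times> index_tuples n m)"
    by (auto simp: length_Suc_conv image_iff)
  moreover have "inj_on (\<lambda>(j, js). j # js) ({..<n} \<times> index_tuples n m)"
    by (auto simp: inj_on_def)
  ultimately show ?thesis
    by (simp add: sum.reindex sum.cartesian_product case_prod_unfold)
qed

fun chain_coeff :: "nat \<Rightarrow> nat list \<Rightarrow> complex" where
  "chain_coeff n (i # j # js) = dft n i j * chain_coeff n (j # js)"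
| "chain_coeff n _ = 1"

lemma cmod_chain_coeff [simp]: "cmod (chain_coeff n js) = 1"
  by (induction n js rule: chain_coeff.induct) (simp_all add: norm_mult)

text \<open>The arguments are plain coordinate functions \<open>z k\<close> for \<open>k < m\<close>, so that the same form can be
  fed with a list of vectors or with the blocks of one long vector.\<close>

definition chain_form :: "nat \<Rightarrow> nat \<Rightarrow> (nat \<Rightarrow> nat \<Rightarrow> complex) \<Rightarrow> complex" where
  "chain_form n m z = (\<Sum>js\<in>index_tuples n m. chain_coeff n js * (\<Prod>k<m. z k (js ! k)))"

text \<open>The part of the form in \<open>Suc m\<close> variables that belongs to a fixed first index; as a function
  of this index it is the vector that the summation from the last variable backwards produces.\<close>

definition chain_vec :: "nat \<Rightarrow> nat \<Rightarrow> (nat \<Rightarrow> nat \<Rightarrow> complex) \<Rightarrow> nat \<Rightarrow> complex" where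
  "chain_vec n m z i =
     (\<Sum>js\<in>index_tuples n m. chain_coeff n (i # js) * (\<Prod>k<Suc m. z k ((i # js) ! k)))"

lemma chain_form_Suc: "chain_form n (Suc m) z = (\<Sum>i<n. chain_vec n m z i)"
  unfolding chain_form_def chain_vec_def by (rule sum_index_tuples_Suc)

lemma chain_vec_0: "chain_vec n 0 z i = z 0 i"
proof -
  have "index_tuples n 0 = {[]}" by auto
  then show ?thesis by (simp add: chain_vec_def)
qed

lemma chain_vec_Suc:
  "chain_vec n (Suc m) z i = z 0 i * (\<Sum>j<n. dft n i j * chain_vec n m (\<lambda>k. z (Suc k)) j)"
  unfolding chain_vec_def sum_index_tuples_Suc prod.lessThan_Suc_shift[of _ "Suc m"]
  by (simp add: sum_distrib_left mult_ac del: prod.lessThan_Suc)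

text \<open>Each induction step applies \<open>dft\<close>, which contributes a factor \<open>n\<close> to the squared \<open>\<ell>\<^sub>2\<close> norm, and
  then multiplies pointwise by entries of the unit disc, which contributes nothing. A termwise
  estimate of the sum would instead lose a factor \<open>n\<^sup>2\<close> in every step.\<close>

lemma chain_vec_bound:
  assumes "\<And>k j. k \<le> m \<Longrightarrow> j < n \<Longrightarrow> cmod (z k j) \<le> 1"
  shows "(\<Sum>i<n. (cmod (chain_vec n m z i))\<^sup>2) \<le> real n ^ Suc m"
  using assms
proof (induction m arbitrary: z)
  case 0
  have "(\<Sum>i<n. (cmod (z 0 i))\<^sup>2) \<le> (\<Sum>i<n. 1)"
    using 0 by (intro sum_mono) (simp add: power_le_one)
  then show ?case by (simp add: chain_vec_0)
next
  case (Suc m)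
  let ?v = "chain_vec n m (\<lambda>k. z (Suc k))"
  have "(cmod (chain_vec n (Suc m) z i))\<^sup>2 \<le> (cmod (\<Sum>j<n. dft n i j * ?v j))\<^sup>2"
    if "i < n" for i
    using Suc.prems[of 0 i] that
    by (auto simp: chain_vec_Suc norm_mult intro!: power_mono mult_left_le_one_le)
  then have "(\<Sum>i<n. (cmod (chain_vec n (Suc m) z i))\<^sup>2)
      \<le> (\<Sum>i<n. (cmod (\<Sum>j<n. dft n i j * ?v j))\<^sup>2)"
    by (intro sum_mono) simp
  also have "\<dots> = real n * (\<Sum>j<n. (cmod (?v j))\<^sup>2)"
    by (rule dft_plancherel)
  also have "\<dots> \<le> real n * real n ^ Suc m"
    using Suc.prems by (intro mult_left_mono Suc.IH) simp_all
  finally show ?case by simp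
qed

lemma chain_form_bound:
  assumes "m \<ge> 1" and "\<And>k j. k < m \<Longrightarrow> j < n \<Longrightarrow> cmod (z k j) \<le> 1"
  shows "cmod (chain_form n m z) \<le> sqrt (real n ^ Suc m)"
proof -
  obtain l where m: "m = Suc l"
    using assms(1) by (cases m) auto
  have "(cmod (chain_form n m z))\<^sup>2 \<le> (\<Sum>i<n. cmod (chain_vec n l z i))\<^sup>2"
    unfolding m chain_form_Suc by (intro power_mono norm_sum) simp
  also have "\<dots> \<le> (\<Sum>i<n. (cmod (chain_vec n l z i))\<^sup>2) * real n"
    using sum_squared_le_sum_of_squares[of "\<lambda>i. cmod (chain_vec n l z i)" "{..<n}"] by simp
  also have "\<dots> \<le> real n ^ Suc l * real n"
    using assms(2) by (intro mult_right_mono chain_vec_bound) (auto simp: m)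
  finally show ?thesis by (intro real_le_rsqrt) (simp add: m mult_ac)
qed

section \<open>Comparing growth rates\<close>

text \<open>Both parts of the theorem end here. The two sides are powers of \<open>n\<close>, and the hypothesis on \<open>q\<close>
  says precisely that the exponent on the left exceeds the one on the right, so their quotient is
  unbounded in \<open>n\<close>.\<close>

lemma no_uniform_constant:
  assumes "m \<ge> 1" and "0 < q" and "q < 2 * real m / (real m + 1)"
    and le: "\<And>n. n \<ge> 1 \<Longrightarrow> (real n ^ m) powr (1 / q) \<le> C * sqrt (real n ^ Suc m)"
  shows False
proof -
  define e where "e = real m / q - (real m + 1) / 2"
  have "e > 0"
    using assms(1-3) by (simp add: e_def field_simps)
  have bound: "real n powr e \<le> C" if "n \<ge> 1" for n
  proof -
    have "real n powr (real m / q) \<le> C * real n powr ((real m + 1) / 2)"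
      using le[OF that] that
      by (simp add: powr_powr powr_half_sqrt[symmetric] add.commute flip: powr_realpow del: power_Suc)
    then show ?thesis
      using that by (simp add: e_def powr_diff divide_le_eq)
  qed
  \<comment> \<open>beyond the \<open>e\<close>-th root of \<open>\<bar>C\<bar>\<close> the bound fails\<close>
  obtain n where n: "real n > max 1 (\<bar>C\<bar> powr (1 / e))"
    using reals_Archimedean2 by blast
  have "C \<le> (\<bar>C\<bar> powr (1 / e)) powr e"
    using \<open>e > 0\<close> by (simp add: powr_powr)
  also have "\<dots> < real n powr e"
    using n \<open>e > 0\<close> by (intro powr_less_mono2) auto
  also have "\<dots> \<le> C"
    using n by (intro bound) auto
  finally show False by simp
qed

section \<open>The polydisc\<close>

lemma polydisc_nonempty: "polydisc n \<noteq> {}"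
proof -
  have "0\<^sub>v n \<in> polydisc n" by (auto simp: polydisc_def linf_norm_def)
  then show ?thesis by blast
qed

lemma polydisc_coordinate: "z \<in> polydisc n \<Longrightarrow> i < n \<Longrightarrow> cmod (z $ i) \<le> 1"
  by (auto simp: polydisc_def linf_norm_def)

section \<open>The multilinear form\<close>

definition chain_multilinear :: "nat \<Rightarrow> nat \<Rightarrow> complex vec list \<Rightarrow> complex" where
  "chain_multilinear n m zs = chain_form n m (\<lambda>k j. zs ! k $ j)"

lemma multilinear_form_chain: "multilinear_form n m (chain_multilinear n m)"
proof -
  \<comment> \<open>Isolating the factor that comes from slot \<open>k\<close> exhibits the linear dependence on it.\<close>
  have upd: "chain_multilinear n m (zs[k := x]) =
      (\<Sum>js\<in>index_tuples n m. x $ (js ! k) *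
         (chain_coeff n js * (\<Prod>l\<in>{..<m} - {k}. zs ! l $ (js ! l))))"
    if "length zs = m" "k < m" for zs k x
  proof -
    have "(\<Prod>l<m. zs[k := x] ! l $ (js ! l))
        = x $ (js ! k) * (\<Prod>l\<in>{..<m} - {k}. zs ! l $ (js ! l))" for js
      using that by (subst prod.remove[of _ k]) (auto intro!: arg_cong2[of _ _ _ _ "(*)"] prod.cong)
    then show ?thesis
      by (simp add: chain_multilinear_def chain_form_def mult_ac)
  qed
  show ?thesis
    unfolding multilinear_form_def
    by (auto simp: upd index_tuples_nth sum_distrib_left distrib_right distrib_left
        mult_ac simp flip: sum.distrib intro!: sum.cong)
qed

lemma chain_multilinear_unit_vec:
  assumes "is \<in> index_tuples n m"
  shows "chain_multilinear n m (map (unit_vec n) is) = chain_coeff n is"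
proof -
  have prod: "(\<Prod>k<m. map (unit_vec n) is ! k $ (js ! k)) = (if js = is then 1 else (0::complex))"
    if js: "js \<in> index_tuples n m" for js
  proof -
    have *: "map (unit_vec n) is ! k $ (js ! k) = (if js ! k = is ! k then 1 else (0::complex))"
      if "k < m" for k
      using that js assms index_tuples_nth[OF js that] index_tuples_nth[OF assms that]
      by (auto simp: unit_vec_def)
    show ?thesis
    proof (cases "js = is")
      case True
      then show ?thesis using * by simp
    next
      case False
      then obtain k where "k < m" "js ! k \<noteq> is ! k"
        using js assms by (auto simp: list_eq_iff_nth_eq)
      then show ?thesis using False * by (auto intro!: prod_zero)
    qed
  qed
  have "chain_multilinear n m (map (unit_vec n) is)
      = (\<Sum>js\<in>index_tuples n m. if js = is then chain_coeff n js else 0)"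
    unfolding chain_multilinear_def chain_form_def
    by (intro sum.cong refl) (simp add: prod del: nth_map)
  also have "\<dots> = chain_coeff n is"
    using assms by (simp only: sum.delta[OF finite_index_tuples] if_True)
  finally show ?thesis .
qed

lemma multilinear_norm_chain:
  assumes "m \<ge> 1"
  shows "multilinear_norm n m (chain_multilinear n m) \<le> sqrt (real n ^ Suc m)"
  unfolding multilinear_norm_def
proof (rule cSUP_least)
  obtain z where "z \<in> polydisc n" using polydisc_nonempty by blast
  then have "replicate m z \<in> {zs. length zs = m \<and> set zs \<subseteq> polydisc n}" by auto
  then show "{zs. length zs = m \<and> set zs \<subseteq> polydisc n} \<noteq> {}" by blast
next
  fix zs assume zs: "zs \<in> {zs. length zs = m \<and> set zs \<subseteq> polydisc n}"
  show "cmod (chain_multilinear n m zs) \<le> sqrt (real n ^ Suc m)"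
    unfolding chain_multilinear_def
  proof (rule chain_form_bound[OF assms])
    fix k j assume "k < m" "j < n"
    then show "cmod (zs ! k $ j) \<le> 1"
      using zs nth_mem[of k zs] by (intro polydisc_coordinate[of _ n]) auto
  qed
qed

section \<open>The polynomial in disjoint blocks of variables\<close>

lemma prod_blocks: "(\<Prod>i<m * n. f i) = (\<Prod>k<m. \<Prod>j<n. f (k * n + j))"
  for f :: "nat \<Rightarrow> 'a::comm_monoid_mult"
proof -
  have "prod f {k * n..<k * n + n} = (\<Prod>j<n. f (k * n + j))" for k
    by (rule prod.reindex_bij_witness[of _ "\<lambda>j. k * n + j" "\<lambda>i. i - k * n"]) auto
  then show ?thesis by (simp flip: prod.nat_group)
qed

lemma sum_blocks: "(\<Sum>i<m * n. f i) = (\<Sum>k<m. \<Sum>j<n. f (k * n + j))"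
  for f :: "nat \<Rightarrow> 'a::comm_monoid_add"
proof -
  have "sum f {k * n..<k * n + n} = (\<Sum>j<n. f (k * n + j))" for k
    by (rule sum.reindex_bij_witness[of _ "\<lambda>j. k * n + j" "\<lambda>i. i - k * n"]) auto
  then show ?thesis by (simp flip: sum.nat_group)
qed

text \<open>The exponent of the monomial that takes the variable number \<open>js ! k\<close> from block number \<open>k\<close>,
  for each \<open>k\<close>.\<close>

definition block_exponent :: "nat \<Rightarrow> nat \<Rightarrow> nat list \<Rightarrow> nat vec" where
  "block_exponent n m js = vec (m * n) (\<lambda>i. if js ! (i div n) = i mod n then 1 else 0)"

lemma block_index_less: "k < m \<Longrightarrow> j < n \<Longrightarrow> k * n + j < m * (n::nat)"
proof -
  assume "k < m" "j < n"
  then have "k * n + j < Suc k * n" by simp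
  also have "\<dots> \<le> m * n" using \<open>k < m\<close> by (intro mult_le_mono1) simp
  finally show ?thesis .
qed

lemma block_exponent_index:
  "k < m \<Longrightarrow> j < n \<Longrightarrow> block_exponent n m js $ (k * n + j) = (if js ! k = j then 1 else 0)"
  by (simp add: block_exponent_def block_index_less)

lemma block_exponent_multi_index:
  assumes "js \<in> index_tuples n m"
  shows "block_exponent n m js \<in> multi_indices (m * n) m"
proof -
  have "(\<Sum>i<m * n. block_exponent n m js $ i) = (\<Sum>k<m. \<Sum>j<n. if js ! k = j then 1 else 0)"
    unfolding sum_blocks by (intro sum.cong refl) (simp add: block_exponent_index)
  also have "\<dots> = (\<Sum>k<m. 1)"
    using index_tuples_nth[OF assms] by (intro sum.cong refl) auto
  finally show ?thesis by (simp add: multi_indices_def block_exponent_def)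
qed

text \<open>The tuple can be read off from the position of the \<open>1\<close> in each block. It is the order of the
  blocks that keeps permuted tuples apart, whose monomials would coincide if all the arguments of
  the form were the same vector.\<close>

lemma inj_on_block_exponent: "inj_on (block_exponent n m) (index_tuples n m)"
proof (rule inj_onI)
  fix js js' assume *: "js \<in> index_tuples n m" "js' \<in> index_tuples n m"
    and eq: "block_exponent n m js = block_exponent n m js'"
  have "js' ! k = js ! k" if "k < m" for k
  proof -
    have "js ! k < n" using index_tuples_nth[OF *(1) that] .
    then have "(if js ! k = js ! k then 1 else 0) = (if js' ! k = js ! k then 1 else (0::nat))"
      using eq block_exponent_index[OF that, of "js ! k" n] by metis
    then show ?thesis by (simp split: if_splits)
  qed
  with * show "js = js'" by (simp add: list_eq_iff_nth_eq)
qed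

lemma monomial_block_exponent:
  assumes "js \<in> index_tuples n m" "dim_vec z = m * n"
  shows "monomial z (block_exponent n m js) = (\<Prod>k<m. z $ (k * n + js ! k))"
proof -
  have "monomial z (block_exponent n m js)
      = (\<Prod>k<m. \<Prod>j<n. if js ! k = j then z $ (k * n + j) else 1)"
    unfolding monomial_def assms(2) prod_blocks
    by (intro prod.cong refl) (simp add: block_exponent_index)
  also have "\<dots> = (\<Prod>k<m. z $ (k * n + js ! k))"
    using index_tuples_nth[OF assms(1)] by (intro prod.cong refl) auto
  finally show ?thesis .
qed

definition chain_poly_coeff :: "nat \<Rightarrow> nat \<Rightarrow> nat vec \<Rightarrow> complex" where
  "chain_poly_coeff n m \<alpha> =
     (if \<alpha> \<in> block_exponent n m ` index_tuples n m
      then chain_coeff n (inv_into (index_tuples n m) (block_exponent n m) \<alpha>) else 0)"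

lemma chain_poly_coeff_block_exponent:
  assumes "js \<in> index_tuples n m"
  shows "chain_poly_coeff n m (block_exponent n m js) = chain_coeff n js"
  unfolding chain_poly_coeff_def inv_into_f_f[OF inj_on_block_exponent assms]
  by (simp only: imageI[OF assms] if_True)

text \<open>Used twice: with \<open>f\<close> a term of the polynomial and with \<open>f\<close> a term of the \<open>q\<close>-th power sum of
  the coefficients. Terms outside the image of \<open>block_exponent\<close> vanish, and by injectivity each
  index tuple accounts for exactly one of the remaining terms.\<close>

lemma sum_chain_poly_coeff:
  fixes f :: "nat vec \<Rightarrow> 'a::comm_monoid_add"
  assumes "\<And>\<alpha>. chain_poly_coeff n m \<alpha> = 0 \<Longrightarrow> f \<alpha> = 0"
  shows "(\<Sum>\<alpha>\<in>multi_indices (m * n) m. f \<alpha>) = (\<Sum>js\<in>index_tuples n m. f (block_exponent n m js))"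
proof -
  have "(\<Sum>\<alpha>\<in>multi_indices (m * n) m. f \<alpha>) = (\<Sum>\<alpha>\<in>block_exponent n m ` index_tuples n m. f \<alpha>)"
  proof (intro sum.mono_neutral_right finite_multi_indices ballI assms)
    show "block_exponent n m ` index_tuples n m \<subseteq> multi_indices (m * n) m"
      by (intro image_subsetI block_exponent_multi_index)
    show "chain_poly_coeff n m \<alpha> = 0"
      if "\<alpha> \<in> multi_indices (m * n) m - block_exponent n m ` index_tuples n m" for \<alpha>
      using that by (simp only: chain_poly_coeff_def Diff_iff if_False)
  qed
  then show ?thesis by (simp only: sum.reindex[OF inj_on_block_exponent] o_def)
qed

lemma hom_poly_chain:
  assumes "z \<in> carrier_vec (m * n)"
  shows "hom_poly (m * n) m (chain_poly_coeff n m) z = chain_form n m (\<lambda>k j. z $ (k * n + j))"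
proof -
  have "hom_poly (m * n) m (chain_poly_coeff n m) z
      = (\<Sum>js\<in>index_tuples n m.
          chain_poly_coeff n m (block_exponent n m js) * monomial z (block_exponent n m js))"
    unfolding hom_poly_def by (rule sum_chain_poly_coeff) simp
  also have "\<dots> = chain_form n m (\<lambda>k j. z $ (k * n + j))"
    unfolding chain_form_def
  proof (intro sum.cong refl)
    fix js assume "js \<in> index_tuples n m"
    with assms show "chain_poly_coeff n m (block_exponent n m js) * monomial z (block_exponent n m js)
        = chain_coeff n js * (\<Prod>k<m. z $ (k * n + js ! k))"
      by (simp only: chain_poly_coeff_block_exponent monomial_block_exponent carrier_vecD)
  qed
  finally show ?thesis .
qed

lemma poly_norm_chain:
  assumes "m \<ge> 1"
  shows "poly_norm (m * n) (hom_poly (m * n) m (chain_poly_coeff n m)) \<le> sqrt (real n ^ Suc m)"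
  unfolding poly_norm_def
proof (rule cSUP_least[OF polydisc_nonempty])
  fix z assume z: "z \<in> polydisc (m * n)"
  then have "hom_poly (m * n) m (chain_poly_coeff n m) z = chain_form n m (\<lambda>k j. z $ (k * n + j))"
    by (intro hom_poly_chain) (simp add: polydisc_def)
  moreover have "cmod (chain_form n m (\<lambda>k j. z $ (k * n + j))) \<le> sqrt (real n ^ Suc m)"
  proof (rule chain_form_bound[OF assms])
    fix k j assume "k < m" "j < n"
    then show "cmod (z $ (k * n + j)) \<le> 1"
      by (intro polydisc_coordinate[OF z] block_index_less)
  qed
  ultimately show "cmod (hom_poly (m * n) m (chain_poly_coeff n m) z) \<le> sqrt (real n ^ Suc m)"
    by (simp only:)
qed

section \<open>Sharpness of the exponent\<close>

theorem theorem10p2: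
  fixes m :: nat and q :: real
  assumes "m \<ge> 1" and "0 < q" and "q < 2 * real m / (real m + 1)"
  shows "\<not> (\<exists>C::real. C > 0 \<and>
             (\<forall>n::nat. n \<ge> 1 \<longrightarrow> (\<forall>a :: nat vec \<Rightarrow> complex.
                (\<Sum>\<alpha>\<in>multi_indices n m. cmod (a \<alpha>) powr q) powr (1 / q)
                  \<le> C * poly_norm n (hom_poly n m a)))) \<and>
         \<not> (\<exists>C::real. C > 0 \<and>
             (\<forall>n::nat. n \<ge> 1 \<longrightarrow> (\<forall>U :: complex vec list \<Rightarrow> complex.
                multilinear_form n m U \<longrightarrow>
                (\<Sum>js\<in>{js. length js = m \<and> set js \<subseteq> {..<n}}. cmod (U (map (unit_vec n) js)) powr q) powr (1 / q)
                  \<le> C * multilinear_norm n m U)))"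
proof (intro conjI notI)
  assume "\<exists>C::real. C > 0 \<and>
             (\<forall>n::nat. n \<ge> 1 \<longrightarrow> (\<forall>a :: nat vec \<Rightarrow> complex.
                (\<Sum>\<alpha>\<in>multi_indices n m. cmod (a \<alpha>) powr q) powr (1 / q)
                  \<le> C * poly_norm n (hom_poly n m a)))"
  then obtain C where "C > 0" and C: "\<And>n a. n \<ge> 1 \<Longrightarrow>
      (\<Sum>\<alpha>\<in>multi_indices n m. cmod (a \<alpha>) powr q) powr (1 / q) \<le> C * poly_norm n (hom_poly n m a)"
    by blast
  show False
  proof (rule no_uniform_constant[OF assms])
    fix n :: nat assume "n \<ge> 1"
    \<comment> \<open>vanishing coefficients do not contribute, because \<open>0 powr q = 0\<close>\<close>
    have "(\<Sum>\<alpha>\<in>multi_indices (m * n) m. cmod (chain_poly_coeff n m \<alpha>) powr q) = real n ^ m"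
    proof (subst sum_chain_poly_coeff)
      show "(\<Sum>js\<in>index_tuples n m. cmod (chain_poly_coeff n m (block_exponent n m js)) powr q)
          = real n ^ m"
        by (simp add: chain_poly_coeff_block_exponent card_index_tuples del: mem_Collect_eq)
    qed simp
    then have "(real n ^ m) powr (1 / q)
        \<le> C * poly_norm (m * n) (hom_poly (m * n) m (chain_poly_coeff n m))"
      using C[of "m * n" "chain_poly_coeff n m"] \<open>n \<ge> 1\<close> \<open>m \<ge> 1\<close> by (simp only:) simp
    also have "\<dots> \<le> C * sqrt (real n ^ Suc m)"
      using \<open>C > 0\<close> \<open>m \<ge> 1\<close> by (intro mult_left_mono poly_norm_chain) auto
    finally show "(real n ^ m) powr (1 / q) \<le> C * sqrt (real n ^ Suc m)" .
  qed
next
  assume "\<exists>C::real. C > 0 \<and>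
             (\<forall>n::nat. n \<ge> 1 \<longrightarrow> (\<forall>U :: complex vec list \<Rightarrow> complex.
                multilinear_form n m U \<longrightarrow>
                (\<Sum>js\<in>{js. length js = m \<and> set js \<subseteq> {..<n}}. cmod (U (map (unit_vec n) js)) powr q) powr (1 / q)
                  \<le> C * multilinear_norm n m U))"
  then obtain C where "C > 0" and C: "\<And>n U. n \<ge> 1 \<Longrightarrow> multilinear_form n m U \<Longrightarrow>
      (\<Sum>js\<in>index_tuples n m. cmod (U (map (unit_vec n) js)) powr q) powr (1 / q)
        \<le> C * multilinear_norm n m U"
    by blast
  show False
  proof (rule no_uniform_constant[OF assms])
    fix n :: nat assume "n \<ge> 1"
    have "(\<Sum>js\<in>index_tuples n m. cmod (chain_multilinear n m (map (unit_vec n) js)) powr q)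
        = (\<Sum>js\<in>index_tuples n m. 1)"
      by (intro sum.cong refl) (simp add: chain_multilinear_unit_vec)
    then have "(real n ^ m) powr (1 / q) \<le> C * multilinear_norm n m (chain_multilinear n m)"
      using C[OF \<open>n \<ge> 1\<close> multilinear_form_chain] by (simp add: card_index_tuples)
    also have "\<dots> \<le> C * sqrt (real n ^ Suc m)"
      using \<open>C > 0\<close> \<open>m \<ge> 1\<close> by (intro mult_left_mono multilinear_norm_chain) auto
    finally show "(real n ^ m) powr (1 / q) \<le> C * sqrt (real n ^ Suc m)" .
  qed
qed

end
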